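(* For every integer $n>24$, the generalized Petersen graph $GP(n,4)$ is not $\ell$-distance-balanced for any integer $\ell$ with $1\le \ell<{\rm diam}(GP(n,4))$. Moreover, $24$ is the smallest integer with this property, i.e., $24$ is the smallest integer $N$ such that for every $n>N$ the graph $GP(n,4)$ is not $\ell$-distance-balanced for any $1\le \ell<{\rm diam}(GP(n,4))$.
   Context: For a connected graph $G$ and $x,y\in V(G)$, $d_G(x,y)$ denotes the distance and ${\rm diam}(G)$ the diameter. Let $W_{xy}=\{w\in V(G): d_G(w,x)<d_G(w,y)\}$. For an integer $\ell$ with $1\le \ell\le {\rm diam}(G)$, $G$ is called $\ell$-distance-balanced if $|W_{xy}|=|W_{yx}|$ for every pair $x,y\in V(G)$ with $d_G(x,y)=\ell$. For integers $n\ge 3$ and $1\le k<n/2$, the generalized Petersen graph $GP(n,k)$ has vertex set $\{u_i: i\in\mathbb{Z}_n\}\cup\{v_i: i\in\mathbb{Z}_n\}$ and edge set $\{u_iu_{i+1}: i\in\mathbb{Z}_n\}\cup\{v_iv_{i+k}: i\in\mathbb{Z}_n\}\cup\{u_iv_i: i\in\mathbb{Z}_n\}$. *)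

theory Defs
  imports Main
begin

definition edge_rel :: "'a set \<Rightarrow> ('a \<Rightarrow> 'a \<Rightarrow> bool) \<Rightarrow> ('a \<times> 'a) set" where
  "edge_rel V E = {(a, b). a \<in> V \<and> b \<in> V \<and> E a b}"

text \<open>Distance: length of a shortest walk (the graphs considered are connected).\<close>
definition gdist :: "'a set \<Rightarrow> ('a \<Rightarrow> 'a \<Rightarrow> bool) \<Rightarrow> 'a \<Rightarrow> 'a \<Rightarrow> nat" where
  "gdist V E x y = (LEAST d. (x, y) \<in> edge_rel V E ^^ d)"

definition gdiam :: "'a set \<Rightarrow> ('a \<Rightarrow> 'a \<Rightarrow> bool) \<Rightarrow> nat" where
  "gdiam V E = Max {gdist V E x y | x y. x \<in> V \<and> y \<in> V}"

definition Wset :: "'a set \<Rightarrow> ('a \<Rightarrow> 'a \<Rightarrow> bool) \<Rightarrow> 'a \<Rightarrow> 'a \<Rightarrow> 'a set" where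
  "Wset V E x y = {w \<in> V. gdist V E w x < gdist V E w y}"

definition dist_balanced :: "'a set \<Rightarrow> ('a \<Rightarrow> 'a \<Rightarrow> bool) \<Rightarrow> nat \<Rightarrow> bool" where
  "dist_balanced V E l \<longleftrightarrow>
     (\<forall>x\<in>V. \<forall>y\<in>V. gdist V E x y = l \<longrightarrow> card (Wset V E x y) = card (Wset V E y x))"

text \<open>Generalized Petersen graph GP(n,k): vertex (False, i) is u_i, vertex (True, i) is v_i, i < n.\<close>
definition GP_V :: "nat \<Rightarrow> (bool \<times> nat) set" where
  "GP_V n = {(b, i). i < n}"

definition GP_E :: "nat \<Rightarrow> nat \<Rightarrow> bool \<times> nat \<Rightarrow> bool \<times> nat \<Rightarrow> bool" where
  "GP_E n k p q = (case (p, q) of ((b, i), (c, j)) \<Rightarrow>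
      (\<not> b \<and> \<not> c \<and> (j = (i + 1) mod n \<or> i = (j + 1) mod n))
    \<or> (b \<and> c \<and> (j = (i + k) mod n \<or> i = (j + k) mod n))
    \<or> (b \<noteq> c \<and> i = j))"

definition GP_nowhere_balanced :: "nat \<Rightarrow> nat \<Rightarrow> bool" where
  "GP_nowhere_balanced n k \<longleftrightarrow>
     (\<forall>l. 1 \<le> l \<and> l < gdiam (GP_V n) (GP_E n k) \<longrightarrow> \<not> dist_balanced (GP_V n) (GP_E n k) l)"

end

theory Submission
  imports Defs
begin

text \<open>Write \<open>f(x)\<close> for the distance from 0 to \<open>x\<close> in the circulant graph on the integers modulo \<open>n\<close> with steps
  \<open>\<plusminus>1\<close> and \<open>\<plusminus>4\<close>. Then \<open>d(u\<^sub>0, v\<^sub>x) = f(x) + 1\<close>, while \<open>d(u\<^sub>0, u\<^sub>x)\<close> and \<open>d(v\<^sub>0, v\<^sub>x)\<close> equal \<open>f(x) + 2\<close> unless the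
  rim alone, respectively steps of length 4 alone, do better. A reflection exchanges any two
  vertices of the same kind, so only the pairs \<open>u\<^sub>0, v\<^sub>j\<close> can be unbalanced. For such a pair
  \<open>|W\<^sub>x\<^sub>y| - |W\<^sub>y\<^sub>x|\<close> is a sum over \<open>i\<close> modulo \<open>n\<close> in which only \<open>i = \<plusminus>1, \<plusminus>2, \<plusminus>3\<close> can contribute positively,
  and in which a multiple \<open>i\<close> of 4 contributes negatively when \<open>f(i)\<close> and \<open>f(j - i)\<close> differ by at most 1.
  If \<open>f(j) \<ge> 6\<close>, no term is positive and a negative one is found halfway between \<open>0\<close> and \<open>j\<close>. For the
  values \<open>f(j) \<le> 5\<close> a suitable \<open>j\<close> is fixed; if \<open>n \<ge> 46\<close> the terms with \<open>i\<close> near 0 do not depend on \<open>n\<close> and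
  already have negative sum, and the finitely many smaller \<open>n\<close> are computed. Every \<open>l\<close> below the
  diameter is of the form \<open>f(j) + 1\<close> because \<open>f\<close> changes by at most 1 from \<open>x\<close> to \<open>x + 1\<close>. For \<open>n = 24\<close> the
  sum for \<open>j = 0\<close> vanishes, so GP(24,4) is 1-distance-balanced.\<close>

subsection \<open>Distances and the sets W in general graphs\<close>

text \<open>A potential that drops by at most 1 along each edge bounds walk lengths from below.
  Greedy descent attains the bound, since every descending edge then lowers \<open>D\<close> by
  exactly 1.\<close>

lemma gdist_eqI:
  fixes D :: "'a \<Rightarrow> nat"
  assumes x: "x \<in> V" "D x = 0" and p: "p \<in> V"
    and step: "\<And>p q. p \<in> V \<Longrightarrow> q \<in> V \<Longrightarrow> E p q \<Longrightarrow> D p \<le> D q + 1"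
    and descent: "\<And>p. p \<in> V \<Longrightarrow> p \<noteq> x \<Longrightarrow> \<exists>q\<in>V. E p q \<and> D q < D p"
  shows "gdist V E p x = D p"
proof -
  have lower: "D q \<le> d" if "(q, x) \<in> edge_rel V E ^^ d" for q d
    using that
  proof (induction d arbitrary: q)
    case 0
    then show ?case using x by simp
  next
    case (Suc d)
    then obtain r where "(q, r) \<in> edge_rel V E" "(r, x) \<in> edge_rel V E ^^ d"
      by (meson relpow_Suc_D2)
    with Suc.IH[of r] step[of q r] show ?case
      by (auto simp: edge_rel_def)
  qed
  have upper: "(q, x) \<in> edge_rel V E ^^ D q" if "q \<in> V" for q
    using that
  proof (induction "D q" arbitrary: q rule: less_induct)
    case less
    show ?case
    proof (cases "q = x")
      case True
      then show ?thesis using x by simp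
    next
      case False
      with descent less.prems obtain r where r: "r \<in> V" "E q r" "D r < D q"
        by blast
      with step less.prems have "D q = Suc (D r)"
        by force
      moreover have "(q, r) \<in> edge_rel V E"
        using r less.prems by (simp add: edge_rel_def)
      ultimately show ?thesis
        using less.hyps r by (metis relpow_Suc_I2)
    qed
  qed
  show ?thesis
    unfolding gdist_def using lower upper[OF p] by (intro Least_equality)
qed

text \<open>Signs turn the comparison of two cardinalities into a single sum that can be reindexed;
  ties contribute 0.\<close>

lemma card_Wset_diff:
  assumes "finite V"
  shows "int (card (Wset V E x y)) - int (card (Wset V E y x)) =
    (\<Sum>w\<in>V. sgn (int (gdist V E w y) - int (gdist V E w x)))"
proof -
  have card: "int (card (Wset V E x y)) = (\<Sum>w\<in>V. of_bool (gdist V E w x < gdist V E w y))" for x y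
    using assms by (simp add: Wset_def Int_def)
  show ?thesis
    unfolding card sum_subtractf[symmetric] by (intro sum.cong) auto
qed

lemma less_gdiam:
  assumes "finite V" "x \<in> V" "y \<in> V" "l < gdist V E x y"
  shows "l < gdiam V E"
proof -
  have "finite {gdist V E x y | x y. x \<in> V \<and> y \<in> V}"
    using assms(1) by (intro finite_image_set2) auto
  then have "gdist V E x y \<le> gdiam V E"
    unfolding gdiam_def using assms by (intro Max_ge) auto
  with assms(4) show ?thesis by simp
qed

lemma less_gdiamE:
  assumes "finite V" "V \<noteq> {}" "l < gdiam V E"
  obtains x y where "x \<in> V" "y \<in> V" "l < gdist V E x y"
proof -
  have "finite {gdist V E x y | x y. x \<in> V \<and> y \<in> V}"
    using assms(1) by (intro finite_image_set2) auto
  moreover have "{gdist V E x y | x y. x \<in> V \<and> y \<in> V} \<noteq> {}"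
    using assms(2) by auto
  ultimately have "gdiam V E \<in> {gdist V E x y | x y. x \<in> V \<and> y \<in> V}"
    unfolding gdiam_def by (intro Max_in)
  with assms(3) that show ?thesis by auto
qed

section \<open>Reindexing sums over residues\<close>

lemma sum_mod_shift:
  fixes g :: "int \<Rightarrow> 'a::comm_monoid_add"
  assumes "0 < n"
  shows "(\<Sum>i\<in>{c..<c + n}. g (i mod n)) = (\<Sum>i\<in>{0..<n}. g i)"
proof (rule sum.reindex_bij_witness[of _ "\<lambda>i. (i - c) mod n + c" "\<lambda>i. i mod n"])
  fix i assume "i \<in> {c..<c + n}"
  then have "(i - c) mod n = i - c" by (intro mod_pos_pos_trivial) auto
  then show "(i mod n - c) mod n + c = i" by (simp add: mod_diff_left_eq)
next
  fix i assume "i \<in> {0..<n}"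
  then show "((i - c) mod n + c) mod n = i" by (simp add: mod_add_left_eq)
qed (use assms pos_mod_bound[of n] in \<open>auto simp: add.commute\<close>)

lemma sum_mod_reflect:
  fixes g :: "int \<Rightarrow> 'a::comm_monoid_add"
  assumes "0 < n"
  shows "(\<Sum>i\<in>{0..<n}. g ((c - i) mod n)) = (\<Sum>i\<in>{0..<n}. g i)"
proof (rule sum.reindex_bij_witness[of _ "\<lambda>i. (c - i) mod n" "\<lambda>i. (c - i) mod n"])
  fix i assume "i \<in> {0..<n}"
  then show "(c - (c - i) mod n) mod n = i" "(c - (c - i) mod n) mod n = i"
    by (simp_all add: mod_diff_right_eq)
qed (use assms in auto)

lemma sum_mod_translate:
  fixes g :: "int \<Rightarrow> 'a::comm_monoid_add"
  assumes "0 < n"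
  shows "(\<Sum>i\<in>{0..<n}. g ((i - c) mod n)) = (\<Sum>i\<in>{0..<n}. g i)"
  using sum_mod_reflect[OF assms, of "\<lambda>k. g ((- k) mod n)" c] sum_mod_reflect[OF assms, of g 0]
  by (simp add: mod_minus_eq)

subsection \<open>Distances in GP(n,4)\<close>

text \<open>The residues of \<open>x\<close> and \<open>- x\<close> are the lengths of the two arcs between residue 0 and
  residue \<open>x\<close> of the cycle.\<close>

definition fold_min :: "(int \<Rightarrow> int) \<Rightarrow> int \<Rightarrow> int \<Rightarrow> int" where
  "fold_min g n x = min (g (x mod n)) (g ((- x) mod n))"

lemma fold_min_minus [simp]: "fold_min g n (- x) = fold_min g n x"
  by (simp add: fold_min_def min.commute)

lemma fold_min_mod [simp]: "fold_min g n (x mod n) = fold_min g n x"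
  by (simp add: fold_min_def mod_minus_eq)

lemma fold_min_le:
  assumes "0 < n" "0 \<le> a" "a \<le> n" "g 0 \<le> g n" "n dvd x - a \<or> n dvd x + a"
  shows "fold_min g n x \<le> g a"
proof -
  have "x mod n = a mod n \<or> (- x) mod n = a mod n"
    using assms(5) by (metis add.commute diff_minus_eq_add dvd_minus_iff minus_diff_eq mod_eq_dvd_iff)
  then have "fold_min g n x \<le> g (a mod n)"
    by (auto simp: fold_min_def)
  also have "\<dots> \<le> g a"
    using assms(2-4) by (cases "a = n") auto
  finally show ?thesis .
qed

lemma fold_minE:
  assumes "0 < n"
  obtains a where "0 \<le> a" "a < n" "fold_min g n x = g a" "n dvd x - a \<or> n dvd x + a"
proof (cases "g (x mod n) \<le> g ((- x) mod n)")
  case True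
  with assms that[of "x mod n"] show ?thesis
    by (simp add: fold_min_def dvd_minus_mod)
next
  case False
  have "n dvd - x - (- x) mod n" by (rule dvd_minus_mod)
  then have "n dvd x + (- x) mod n" by (metis dvd_minus_iff minus_add_distrib uminus_add_conv_diff add.commute minus_minus)
  with False assms that[of "(- x) mod n"] show ?thesis
    by (simp add: fold_min_def)
qed

text \<open>For \<open>a \<ge> 0\<close>, the least number of steps \<open>\<plusminus>1\<close> and \<open>\<plusminus>4\<close> leading from 0 to \<open>a\<close> in the integers.\<close>

definition hop :: "int \<Rightarrow> int" where
  "hop a = a div 4 + min 2 (a mod 4)"

text \<open>Between inner vertices, steps of length 4 alone avoid the two spokes needed to reach the rim.\<close>

definition inner_hop :: "int \<Rightarrow> int" where
  "inner_hop a = (if 4 dvd a then a div 4 else hop a + 2)"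

text \<open>Unit steps (on the rim) and steps of length 4 (inside) can be taken in any order, so a
  shortest route groups them: one spoke suffices between unlike kinds, two between like
  kinds.\<close>

definition gp_dist :: "int \<Rightarrow> bool \<Rightarrow> bool \<Rightarrow> int \<Rightarrow> int" where
  "gp_dist n b c x =
    (if b \<noteq> c then fold_min hop n x + 1
     else if b then fold_min inner_hop n x
     else min (fold_min (\<lambda>a. a) n x) (fold_min hop n x + 2))"

definition descends :: "int \<Rightarrow> bool \<Rightarrow> bool \<Rightarrow> int \<Rightarrow> bool" where
  "descends n b c x \<longleftrightarrow> gp_dist n (\<not> b) c x < gp_dist n b c x \<or>
    (\<exists>s\<in>{if b then 4 else 1, if b then - 4 else - 1}. gp_dist n b c (x + s) < gp_dist n b c x)"

lemma gp_dist_minus [simp]: "gp_dist n b c (- x) = gp_dist n b c x"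
  by (simp add: gp_dist_def)

lemma gp_dist_mod [simp]: "gp_dist n b c (x mod n) = gp_dist n b c x"
  by (simp add: gp_dist_def)

lemma int_mod4_cases:
  fixes a :: int
  obtains q where "a = 4 * q" | q where "a = 4 * q + 1" | q where "a = 4 * q + 2" | q where "a = 4 * q + 3"
proof -
  have "a = 4 * (a div 4) + a mod 4" by simp
  moreover have "a mod 4 = 0 \<or> a mod 4 = 1 \<or> a mod 4 = 2 \<or> a mod 4 = 3" by presburger
  ultimately show thesis using that by (metis add.right_neutral)
qed

lemma hop_eq [simp]:
  "hop (4 * q) = q" "hop (4 * q + 1) = q + 1" "hop (4 * q + 2) = q + 2" "hop (4 * q + 3) = q + 2"
  by (simp_all add: hop_def)

lemma hop_add4 [simp]: "hop (a + 4) = hop a + 1"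
  by (simp add: hop_def)

lemma hop_diff4 [simp]: "hop (a - 4) = hop a - 1"
  using hop_add4[of "a - 4"] by simp

lemma hop_Suc: "\<bar>hop (a + 1) - hop a\<bar> \<le> 1"
proof (cases a rule: int_mod4_cases)
  case (4 q)
  then have "hop (a + 1) = hop (4 * (q + 1))" by (simp add: algebra_simps)
  with 4 show ?thesis by simp
qed (simp_all add: add.assoc)

lemma hop_pred: "hop (a - 1) \<le> hop a + 1"
  using hop_Suc[of "a - 1"] by simp

text \<open>The slack is 0 for multiples of 4 and largest, namely 6, for residue 2.\<close>

lemma hop_lower: "a \<le> 4 * hop a"
  and hop_upper: "4 * hop a \<le> a + 6"
  and hop_le_self: "0 \<le> a \<Longrightarrow> hop a \<le> a"
  by (cases a rule: int_mod4_cases; simp)+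

lemma hop_le_0: "0 \<le> a \<Longrightarrow> hop a \<le> 0 \<Longrightarrow> a = 0"
  using hop_lower[of a] by simp

lemma inner_hop_add4 [simp]: "inner_hop (a + 4) = inner_hop a + 1"
  and inner_hop_diff4 [simp]: "inner_hop (a - 4) = inner_hop a - 1"
  and inner_hop_upper: "inner_hop a \<le> hop a + 2"
  and inner_hop_lower: "hop a \<le> inner_hop a"
proof -
  have *: "inner_hop (b + 4) = inner_hop b + 1" for b
    by (simp add: inner_hop_def)
  show "inner_hop (a + 4) = inner_hop a + 1" by (rule *)
  show "inner_hop (a - 4) = inner_hop a - 1" using *[of "a - 4"] by simp
qed (auto simp: inner_hop_def hop_def)

lemma small_int_cases:
  fixes a :: int
  assumes "0 \<le> a" "a < 4"
  obtains "a = 0" | "a = 1" | "a = 2" | "a = 3"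
  using assms by linarith

lemma hop_small: "hop 0 = 0" "hop 1 = 1" "hop 2 = 2" "hop 3 = 2" "hop 4 = 1"
  "inner_hop 0 = 0" "inner_hop 1 = 3" "inner_hop 2 = 4" "inner_hop 3 = 4"
  by (simp_all add: hop_def inner_hop_def)

lemma dvd_shift:
  fixes n x :: int
  shows "n dvd x + a \<Longrightarrow> n dvd (x + s) + (a - s)"
  by (simp add: algebra_simps)

section \<open>Step and descent properties of the closed distance formula\<close>

context
  fixes n :: int
  assumes n: "24 \<le> n"
begin

lemma hop_fold_le:
  assumes "0 \<le> a" "a \<le> n" "n dvd x - a \<or> n dvd x + a"
  shows "fold_min hop n x \<le> hop a"
  using assms n hop_lower[of n] by (intro fold_min_le) (auto simp: hop_small)

lemma inner_fold_le:
  assumes "0 \<le> a" "a \<le> n" "n dvd x - a \<or> n dvd x + a"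
  shows "fold_min inner_hop n x \<le> inner_hop a"
  using assms n hop_lower[of n] inner_hop_lower[of n]
  by (intro fold_min_le) (auto simp: hop_small)

lemma cyc_fold_le:
  assumes "0 \<le> a" "a \<le> n" "n dvd x - a \<or> n dvd x + a"
  shows "fold_min (\<lambda>a. a) n x \<le> a"
  using assms n by (intro fold_min_le) auto

lemma n_pos: "0 < n" using n by simp

lemma fold_nonneg:
  "0 \<le> fold_min hop n x" "0 \<le> fold_min inner_hop n x" "0 \<le> fold_min (\<lambda>a. a) n x"
proof -
  have "0 \<le> hop a" "0 \<le> inner_hop a" if "0 \<le> a" for a
    using that hop_lower[of a] inner_hop_lower[of a] by linarith+
  then show "0 \<le> fold_min hop n x" "0 \<le> fold_min inner_hop n x" "0 \<le> fold_min (\<lambda>a. a) n x"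
    using n_pos by (simp_all add: fold_min_def)
qed

text \<open>In the fourth and fifth hypotheses the step \<open>s\<close> jumps over residue 0.\<close>

lemma fold_step:
  assumes "g 0 \<le> g n"
    and "\<And>a. 0 \<le> a \<Longrightarrow> g (a + s) \<le> g a + 1"
    and "\<And>a. s \<le> a \<Longrightarrow> g (a - s) \<le> g a + 1"
    and "\<And>a. 0 \<le> a \<Longrightarrow> a < s \<Longrightarrow> g (s - a) \<le> g a + 1"
    and "\<And>a. 0 < a \<Longrightarrow> a < s \<Longrightarrow> g a \<le> g (n + a - s) + 1"
    and "0 < s" "s < n"
  shows "fold_min g n (x + s) \<le> fold_min g n x + 1"
proof -
  obtain a where a: "0 \<le> a" "a < n" "fold_min g n x = g a" "n dvd x - a \<or> n dvd x + a"
    using fold_minE[OF n_pos] by blast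
  from a(4) show ?thesis
  proof
    assume d: "n dvd x - a"
    show ?thesis
    proof (cases "a + s \<le> n")
      case True
      have "fold_min g n (x + s) \<le> g (a + s)"
        using d a True assms n_pos by (intro fold_min_le) (auto simp: dvd_shift)
      with assms(2)[of a] a show ?thesis by simp
    next
      case False
      have "n dvd x + s - (a + s - n)"
        using dvd_add[OF d dvd_refl] by (simp add: algebra_simps)
      then have "fold_min g n (x + s) \<le> g (a + s - n)"
        using a False assms n_pos by (intro fold_min_le) auto
      with assms(5)[of "a + s - n"] a False show ?thesis by (simp add: algebra_simps)
    qed
  next
    assume d: "n dvd x + a"
    show ?thesis
    proof (cases "s \<le> a")
      case True
      have "fold_min g n (x + s) \<le> g (a - s)"
        using d a True assms n_pos by (intro fold_min_le) (auto simp: dvd_shift)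
      with assms(3)[of a] a True show ?thesis by simp
    next
      case False
      have "n dvd (x + s) - (s - a)"
        using d by (simp add: algebra_simps)
      then have "fold_min g n (x + s) \<le> g (s - a)"
        using a False assms n_pos by (intro fold_min_le) auto
      with assms(4)[of a] a False show ?thesis by simp
    qed
  qed
qed

text \<open>By evenness, the hypothesis at \<open>- x - s\<close> is the inequality in the other
  direction.\<close>

lemma fold_step_back:
  assumes "\<And>x. fold_min g n (x + s) \<le> fold_min g n x + 1"
  shows "\<bar>fold_min g n (x + s) - fold_min g n x\<bar> \<le> 1"
  using assms[of x] assms[of "- x - s"] fold_min_minus[of g n x] fold_min_minus[of g n "x + s"]
  by simp

lemma hop_step1: "\<bar>fold_min hop n (x + 1) - fold_min hop n x\<bar> \<le> 1"
proof (intro fold_step_back fold_step)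
  show "hop (1 - a) \<le> hop a + 1" if "0 \<le> a" "a < 1" for a
    proof -
    from that have "a = 0" by linarith
    then show ?thesis by (simp add: hop_small)
  qed
  show "hop (a + 1) \<le> hop a + 1" for a
    using hop_Suc[of a] by simp
qed (use n hop_lower[of n] in \<open>auto simp: hop_small hop_pred\<close>)

lemma hop_step4: "\<bar>fold_min hop n (x + 4) - fold_min hop n x\<bar> \<le> 1"
proof (intro fold_step_back fold_step)
  show "hop (4 - a) \<le> hop a + 1" if "0 \<le> a" "a < 4" for a
    using that by (cases rule: small_int_cases) (auto simp: hop_small)
  show "hop a \<le> hop (n + a - 4) + 1" if "0 < a" "a < 4" for a
    using that n hop_upper[of a] hop_lower[of "n + a - 4"] by linarith
qed (use n hop_lower[of n] in \<open>auto simp: hop_small\<close>)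

lemma inner_step4: "\<bar>fold_min inner_hop n (x + 4) - fold_min inner_hop n x\<bar> \<le> 1"
proof (intro fold_step_back fold_step)
  show "inner_hop (4 - a) \<le> inner_hop a + 1" if "0 \<le> a" "a < 4" for a
    using that by (cases rule: small_int_cases) (auto simp: inner_hop_def hop_def)
  show "inner_hop a \<le> inner_hop (n + a - 4) + 1" if "0 < a" "a < 4" for a
    using that n hop_upper[of a] inner_hop_upper[of a] hop_lower[of "n + a - 4"] inner_hop_lower[of "n + a - 4"]
    by linarith
qed (use n hop_lower[of n] inner_hop_lower[of n] in \<open>auto simp: hop_small\<close>)

lemma cyc_step1: "\<bar>fold_min (\<lambda>a. a) n (x + 1) - fold_min (\<lambda>a. a) n x\<bar> \<le> 1"
proof (rule fold_step_back, rule fold_step)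
qed (use n in auto)

lemma hop_le_cyc: "fold_min hop n x \<le> fold_min (\<lambda>a. a) n x"
proof -
  obtain a where a: "0 \<le> a" "a < n" "fold_min (\<lambda>a. a) n x = a" "n dvd x - a \<or> n dvd x + a"
    using fold_minE[OF n_pos, of "\<lambda>a. a" x] by blast
  with hop_fold_le[of a x] hop_le_self[of a] show ?thesis by simp
qed

lemma inner_le: "fold_min inner_hop n x \<le> fold_min hop n x + 2"
  using inner_hop_upper[of "x mod n"] inner_hop_upper[of "(- x) mod n"]
  by (auto simp: fold_min_def min_def)

lemma hop_le_inner: "fold_min hop n x \<le> fold_min inner_hop n x"
  using inner_hop_lower[of "x mod n"] inner_hop_lower[of "(- x) mod n"]
  by (auto simp: fold_min_def min_def)

lemma gp_dist_step:
  "\<bar>gp_dist n b c (x + (if b then 4 else 1)) - gp_dist n b c x\<bar> \<le> 1"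
  using hop_step1[of x] hop_step4[of x] inner_step4[of x] cyc_step1[of x]
  by (cases b; cases c) (auto simp: gp_dist_def min_def)

lemma gp_dist_spoke: "\<bar>gp_dist n (\<not> b) c x - gp_dist n b c x\<bar> \<le> 1"
  using inner_le[of x] hop_le_inner[of x] hop_le_cyc[of x]
  by (cases b; cases c) (auto simp: gp_dist_def)

lemma gp_dist_nonneg: "0 \<le> gp_dist n b c x"
  using fold_nonneg by (auto simp: gp_dist_def)

text \<open>The second case is phrased with \<open>- x\<close>, so that an argument for one arc also
  serves the other by reflection.\<close>

lemma fold_cases:
  assumes "\<And>a. 0 \<le> a \<Longrightarrow> a < n \<Longrightarrow> fold_min g n x = g a \<Longrightarrow> n dvd x - a \<Longrightarrow> P x"
    and "\<And>a. 0 \<le> a \<Longrightarrow> a < n \<Longrightarrow> fold_min g n x = g a \<Longrightarrow> n dvd - x - a \<Longrightarrow> P x"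
  shows "P x"
proof -
  obtain a where a: "0 \<le> a" "a < n" "fold_min g n x = g a" "n dvd x - a \<or> n dvd x + a"
    using fold_minE[OF n_pos] by blast
  moreover have "n dvd - x - a \<longleftrightarrow> n dvd x + a"
    by (metis dvd_minus_iff minus_add_distrib uminus_add_conv_diff add.commute)
  ultimately show ?thesis using assms by blast
qed

lemma descends_minus: "descends n b c (- x) \<longleftrightarrow> descends n b c x"
proof -
  have "gp_dist n b c (- x + s) = gp_dist n b c (x + - s)" for s
    using gp_dist_minus[of n b c "x + - s"] by simp
  then show ?thesis
    unfolding descends_def by auto
qed

lemma fold_pred:
  assumes "0 \<le> a" "a < n" "n dvd x - a"
  shows "s \<le> a \<Longrightarrow> 0 < s \<Longrightarrow> fold_min hop n (x - s) \<le> hop (a - s)"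
    and "s \<le> a \<Longrightarrow> 0 < s \<Longrightarrow> fold_min inner_hop n (x - s) \<le> inner_hop (a - s)"
    and "s \<le> a \<Longrightarrow> 0 < s \<Longrightarrow> fold_min (\<lambda>a. a) n (x - s) \<le> a - s"
    and "fold_min hop n (x + 1) \<le> hop (a + 1)"
  using assms n
  by (auto intro!: hop_fold_le inner_fold_le cyc_fold_le)

lemma descends_spoke:
  assumes "0 \<le> a" "a < n" "n dvd x - a" "fold_min hop n x = hop a" 
  shows "descends n True False x" "descends n False True x"
proof -
  show "descends n True False x"
  proof (cases "4 \<le> a")
    case True
    then show ?thesis using fold_pred(1)[OF assms(1-3), of 4] assms(4)
      by (auto simp: descends_def gp_dist_def)
  next
    case False
    then have "0 \<le> a" "a < 4" using assms by auto
    then show ?thesis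
    proof (cases rule: small_int_cases)
      case 4
      \<comment> \<open>The cheapest way from 3 to 0 is 4 - 1, so the step of length 4 overshoots to
        residue -1.\<close>
      have "n dvd (x - 4) + 1" using assms(3) 4 by simp
      then have "fold_min hop n (x - 4) \<le> hop 1" using n by (intro hop_fold_le) auto
      then show ?thesis using assms 4 by (simp add: descends_def gp_dist_def hop_small)
    qed (use assms cyc_fold_le[of a x] in \<open>auto simp: descends_def gp_dist_def hop_small\<close>)
  qed
  \<comment> \<open>Modulo 4, residues 1 and 2 descend by the step -1, residue 3 by the step +1 to
    the next multiple of 4, and residue 0 by its spoke.\<close>
  have "1 \<le> a \<and> hop (a - 1) < hop a \<or> hop (a + 1) < hop a \<or> inner_hop a \<le> hop a"
  proof (cases a rule: int_mod4_cases)
    case (4 q)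
    then have "hop (a + 1) = hop (4 * (q + 1))" by (simp add: algebra_simps)
    with 4 show ?thesis by simp
  qed (use assms(1) in \<open>auto simp: inner_hop_def simp flip: add_diff_eq\<close>)
  then show "descends n False True x"
    using fold_pred(1)[OF assms(1-3), of 1] fold_pred(4)[OF assms(1-3)] assms(4)
      inner_fold_le[OF assms(1) less_imp_le[OF assms(2)] disjI1[OF assms(3)]]
    by (auto simp: descends_def gp_dist_def)
qed

lemma descends_rim:
  assumes "gp_dist n False False x > 0"
  shows "descends n False False x"
proof (cases "fold_min (\<lambda>a. a) n x \<le> fold_min hop n x + 2")
  case True
  show ?thesis
  proof (rule fold_cases[where g = "\<lambda>a. a" and P = "\<lambda>x. descends n False False x"])
    have *: "descends n False False x" if "0 \<le> a" "a < n" "n dvd x - a" "fold_min (\<lambda>a. a) n x = a"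
      "a > 0" "a \<le> fold_min hop n x + 2" for a x
      using that fold_pred(3)[OF that(1-3), of 1]
      by (auto simp: descends_def gp_dist_def)
    fix a assume a: "0 \<le> a" "a < n" "fold_min (\<lambda>a. a) n x = a"
    with assms True have "a > 0" "a \<le> fold_min hop n x + 2" by (auto simp: gp_dist_def)
    with *[of a x] *[of a "- x"] a descends_minus[of False False x]
    show "n dvd x - a \<Longrightarrow> descends n False False x" "n dvd - x - a \<Longrightarrow> descends n False False x"
      by auto
  qed
next
  case False
  then show ?thesis by (auto simp: descends_def gp_dist_def)
qed

lemma descends_inner:
  assumes "0 \<le> a" "a < n" "n dvd x - a" "fold_min inner_hop n x = inner_hop a" "inner_hop a > 0"
  shows "descends n True True x"
proof (cases "4 dvd a")
  case True
  with assms have "4 \<le> a" by (auto simp: inner_hop_def)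
  then show ?thesis using fold_pred(2)[OF assms(1-3), of 4] assms(4)
    by (auto simp: descends_def gp_dist_def)
next
  case False
  then show ?thesis
    using hop_fold_le[of a x] assms by (auto simp: descends_def gp_dist_def inner_hop_def)
qed

lemma gp_dist_descends:
  assumes "gp_dist n b c x > 0"
  shows "descends n b c x"
proof -
  consider "b \<noteq> c" | "b" "c" | "\<not> b" "\<not> c" by blast
  then show ?thesis
  proof cases
    case 1
    show ?thesis
    proof (rule fold_cases[where g = hop and P = "\<lambda>x. descends n b c x"])
      fix a assume "0 \<le> a" "a < n" "fold_min hop n x = hop a"
      with descends_spoke[of a x] descends_spoke[of a "- x"] 1 descends_minus[of b c x]
      show "n dvd x - a \<Longrightarrow> descends n b c x" "n dvd - x - a \<Longrightarrow> descends n b c x"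
        by (cases b; cases c; auto)+
    qed
  next
    case 2
    show ?thesis
    proof (rule fold_cases[where g = inner_hop and P = "\<lambda>x. descends n b c x"])
      fix a assume "0 \<le> a" "a < n" "fold_min inner_hop n x = inner_hop a"
      with descends_inner[of a x] descends_inner[of a "- x"] 2 descends_minus[of b c x] assms
      show "n dvd x - a \<Longrightarrow> descends n b c x" "n dvd - x - a \<Longrightarrow> descends n b c x"
        by (auto simp: gp_dist_def)
    qed
  next
    case 3
    with descends_rim assms show ?thesis by auto
  qed
qed

lemma hop_dist_eq_0:
  assumes "fold_min hop n x = 0"
  shows "n dvd x"
proof -
  obtain a where a: "0 \<le> a" "a < n" "fold_min hop n x = hop a" "n dvd x - a \<or> n dvd x + a"
    using fold_minE[OF n_pos] by blast
  with assms hop_le_0[of a] show ?thesis by auto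
qed

lemma gp_dist_eq_0_iff: "gp_dist n b c x = 0 \<longleftrightarrow> b = c \<and> n dvd x"
proof
  assume 0: "gp_dist n b c x = 0"
  have bc: "b = c" using 0 fold_nonneg(1)[of x] by (auto simp: gp_dist_def split: if_splits)
  have "fold_min hop n x = 0"
    using 0 bc hop_le_cyc[of x] hop_le_inner[of x] fold_nonneg(1)[of x]
    by (cases b) (auto simp: gp_dist_def min_def split: if_splits)
  with hop_dist_eq_0 bc show "b = c \<and> n dvd x" by blast
next
  assume "b = c \<and> n dvd x"
  then show "gp_dist n b c x = 0"
    by (auto simp: gp_dist_def fold_min_def hop_small dvd_imp_mod_0 mod_0_imp_dvd)
qed

end

lemma gp_dist_cong: "x mod n = y mod n \<Longrightarrow> gp_dist n b c x = gp_dist n b c y"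
  by (metis gp_dist_mod)

lemma gp_dist_mod_diff [simp]:
  "gp_dist n b c (x mod n - y) = gp_dist n b c (x - y)"
  "gp_dist n b c (y - x mod n) = gp_dist n b c (y - x)"
  by (auto intro!: gp_dist_cong simp: mod_diff_left_eq mod_diff_right_eq)

lemma gp_dist_commute: "gp_dist n b c x = gp_dist n c b x"
  by (auto simp: gp_dist_def)

lemma gp_dist_flip: "gp_dist n b c (x - y) = gp_dist n b c (y - x)"
  using gp_dist_minus[of n b c "x - y"] by simp

section \<open>The closed formula is the graph distance\<close>

lemma finite_GP_V [simp]: "finite (GP_V n)"
  by (rule finite_subset[of _ "UNIV \<times> {..<n}"]) (auto simp: GP_V_def)

lemma GP_V_iff [simp]: "(b, i) \<in> GP_V n \<longleftrightarrow> i < n"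
  by (simp add: GP_V_def)

lemma sum_GP_V:
  fixes g :: "bool \<times> nat \<Rightarrow> int"
  shows "(\<Sum>w\<in>GP_V n. g w) = (\<Sum>i\<in>{0..<int n}. g (False, nat i) + g (True, nat i))"
proof -
  have "(\<Sum>w\<in>GP_V n. g w) = (\<Sum>b\<in>UNIV. \<Sum>i<n. g (b, i))"
    unfolding sum.cartesian_product by (rule sum.cong) (auto simp: GP_V_def)
  also have "\<dots> = (\<Sum>i<n. g (False, i) + g (True, i))"
    by (simp add: UNIV_bool sum.distrib)
  also have "\<dots> = (\<Sum>i\<in>{0..<int n}. g (False, nat i) + g (True, nat i))"
    by (rule sum.reindex_bij_witness[of _ nat int]) auto
  finally show ?thesis .
qed

lemma GP_E_cases:
  assumes "GP_E n 4 (b, i) (b', i')" "i < n" "i' < n"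
  obtains "b' = (\<not> b)" "i' = i"
  | "b' = b" "int i' mod int n = (int i + (if b then 4 else 1)) mod int n"
  | "b' = b" "int i mod int n = (int i' + (if b then 4 else 1)) mod int n"
  using assms by (auto simp: GP_E_def zmod_int add.commute split: if_splits)

lemma GP_E_shift:
  assumes "0 < n" "i < n" "s \<in> {if b then 4 else 1, if b then - 4 else - 1}"
  shows "GP_E n 4 (b, i) (b, nat ((int i + s) mod int n))"
proof -
  define t where "t = (if b then 4 else 1 :: nat)"
  define i' where "i' = nat ((int i + s) mod int n)"
  have i': "int i' = (int i + s) mod int n"
    using assms(1) by (simp add: i'_def)
  from assms(3) consider "s = int t" | "s = - int t"
    by (auto simp: t_def split: if_splits)
  then have "i' = (i + t) mod n \<or> i = (i' + t) mod n"
  proof cases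
    case 1
    then have "int i' = int ((i + t) mod n)" by (simp add: i' zmod_int)
    then show ?thesis by simp
  next
    case 2
    then have "int ((i' + t) mod n) = int i"
      using assms(2) by (simp add: i' zmod_int mod_add_left_eq)
    then show ?thesis by simp
  qed
  then show ?thesis
    unfolding i'_def[symmetric] by (auto simp: GP_E_def t_def split: if_splits)
qed

lemma gdist_GP:
  assumes n: "24 \<le> n" and "i < n" "j < n"
  shows "int (gdist (GP_V n) (GP_E n 4) (b, i) (c, j)) = gp_dist (int n) b c (int i - int j)"
proof -
  have n': "24 \<le> int n" using n by simp
  define D where "D p = nat (gp_dist (int n) (fst p) c (int (snd p) - int j))" for p :: "bool \<times> nat"
  have "gdist (GP_V n) (GP_E n 4) (b, i) (c, j) = D (b, i)"
  proof (rule gdist_eqI)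
    show "D (c, j) = 0"
      using gp_dist_eq_0_iff[OF n', of c c 0] by (simp add: D_def)
  next
    fix p q assume pq: "p \<in> GP_V n" "q \<in> GP_V n" "GP_E n 4 p q"
    obtain b i b' i' where [simp]: "p = (b, i)" "q = (b', i')" by fastforce
    have "GP_E n 4 (b, i) (b', i')" "i < n" "i' < n"
      using pq by simp_all
    then have "gp_dist (int n) b c (int i - int j) \<le> gp_dist (int n) b' c (int i' - int j) + 1"
    proof (cases rule: GP_E_cases)
      case 1
      then show ?thesis
        using gp_dist_spoke[OF n', of b c "int i - int j"] 1 by simp
    next
      case 2
      have "gp_dist (int n) b c (int i' - int j)
          = gp_dist (int n) b c (int i - int j + (if b then 4 else 1))"
        using gp_dist_mod_diff(1)[of "int n" b c "int i'" "int j"]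
          gp_dist_mod_diff(1)[of "int n" b c "int i + (if b then 4 else 1)" "int j"]
        unfolding 2(2) by (simp add: algebra_simps)
      then show ?thesis
        using gp_dist_step[OF n', of b c "int i - int j"] 2 by simp
    next
      case 3
      have "gp_dist (int n) b c (int i - int j)
          = gp_dist (int n) b c (int i' - int j + (if b then 4 else 1))"
        using gp_dist_mod_diff(1)[of "int n" b c "int i" "int j"]
          gp_dist_mod_diff(1)[of "int n" b c "int i' + (if b then 4 else 1)" "int j"]
        unfolding 3(2) by (simp add: algebra_simps)
      then show ?thesis
        using gp_dist_step[OF n', of b c "int i' - int j"] 3 by simp
    qed
    then show "D p \<le> D q + 1"
      by (simp add: D_def nat_le_iff gp_dist_nonneg[OF n'])
  next
    fix p assume p: "p \<in> GP_V n" "p \<noteq> (c, j)"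
    obtain b i where [simp]: "p = (b, i)" by fastforce
    have i: "i < n" using p by simp
    have "gp_dist (int n) b c (int i - int j) \<noteq> 0"
    proof
      assume "gp_dist (int n) b c (int i - int j) = 0"
      then have "b = c" "int n dvd int i - int j"
        using gp_dist_eq_0_iff[OF n'] by auto
      then have "int i mod int n = int j mod int n" by (simp add: mod_eq_dvd_iff)
      with i assms(3) \<open>b = c\<close> p(2) show False by simp
    qed
    then have pos: "0 < gp_dist (int n) b c (int i - int j)"
      using gp_dist_nonneg[OF n', of b c "int i - int j"] by simp
    from gp_dist_descends[OF n' pos] consider
      "gp_dist (int n) (\<not> b) c (int i - int j) < gp_dist (int n) b c (int i - int j)"
      | s where "s \<in> {if b then 4 else 1, if b then - 4 else - 1}"
        "gp_dist (int n) b c (int i - int j + s) < gp_dist (int n) b c (int i - int j)"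
      unfolding descends_def by blast
    then show "\<exists>q\<in>GP_V n. GP_E n 4 p q \<and> D q < D p"
    proof cases
      case 1
      with i pos show ?thesis
        by (intro bexI[of _ "(\<not> b, i)"]) (auto simp: D_def GP_E_def)
    next
      case (2 s)
      have "gp_dist (int n) b c ((int i + s) mod int n - int j) = gp_dist (int n) b c (int i - int j + s)"
        by (simp add: algebra_simps)
      with 2 i pos GP_E_shift[of n i s b] n show ?thesis
        by (intro bexI[of _ "(b, nat ((int i + s) mod int n))"]) (auto simp: D_def nat_less_iff)
    qed
  qed (use assms in auto)
  then show ?thesis
    using gp_dist_nonneg[OF n'] by (simp add: D_def)
qed

subsection \<open>Comparing the two sets W\<close>

text \<open>The joint contribution of \<open>u\<^sub>i\<close> and \<open>v\<^sub>j\<^sub>-\<^sub>i\<close> to \<open>|W\<^sub>x\<^sub>y| - |W\<^sub>y\<^sub>x|\<close> for \<open>x = u\<^sub>0\<close>, \<open>y = v\<^sub>j\<close>: this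
  pairing puts the same distance \<open>d(u\<^sub>0, v\<^sub>j\<^sub>-\<^sub>i)\<close> in both summands, so they cancel unless it lies between
  (or equals one of) \<open>d(u\<^sub>0, u\<^sub>i)\<close> and \<open>d(v\<^sub>0, v\<^sub>i)\<close>.\<close>

definition gp_term :: "int \<Rightarrow> int \<Rightarrow> int \<Rightarrow> int" where
  "gp_term n j i =
    sgn (gp_dist n True False (j - i) - gp_dist n False False i)
    + sgn (gp_dist n True True i - gp_dist n True False (j - i))"

definition gp_excess :: "int \<Rightarrow> int \<Rightarrow> int" where
  "gp_excess n j = (\<Sum>i\<in>{0..<n}. gp_term n j i)"

lemma card_Wset_GP_diff:
  assumes "24 \<le> n" "a < n" "a' < n"
  shows "int (card (Wset (GP_V n) (GP_E n 4) (b, a) (b', a')))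
      - int (card (Wset (GP_V n) (GP_E n 4) (b', a') (b, a)))
    = (\<Sum>i\<in>{0..<int n}. \<Sum>c\<in>UNIV.
        sgn (gp_dist (int n) c b' (i - int a') - gp_dist (int n) c b (i - int a)))"
  using assms
  by (auto simp: card_Wset_diff sum_GP_V gdist_GP UNIV_bool intro!: sum.cong)

text \<open>Rim vertices are reindexed by a translation and inner vertices by a reflection, which
  produces the pairing used in \<open>gp_term\<close>.\<close>

lemma card_Wset_GP_diff_spoke:
  assumes "24 \<le> n" "a < n" "a' < n"
  shows "int (card (Wset (GP_V n) (GP_E n 4) (False, a) (True, a')))
      - int (card (Wset (GP_V n) (GP_E n 4) (True, a') (False, a)))
    = gp_excess (int n) (int a' - int a)"
proof -
  let ?d = "gp_dist (int n)" and ?j = "int a' - int a"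
  have "(\<Sum>i\<in>{0..<int n}. sgn (?d False True (i - int a') - ?d False False (i - int a)))
      = (\<Sum>i\<in>{0..<int n}. sgn (?d True False (?j - i) - ?d False False i))"
    using sum_mod_translate[of "int n" "\<lambda>i. sgn (?d True False (?j - i) - ?d False False i)" "int a"] assms
      gp_dist_commute[of "int n" True False] gp_dist_flip[of "int n" False True _ "int a'"]
    by simp
  moreover have "(\<Sum>i\<in>{0..<int n}. sgn (?d True True (i - int a') - ?d True False (i - int a)))
      = (\<Sum>i\<in>{0..<int n}. sgn (?d True True i - ?d True False (?j - i)))"
    using sum_mod_reflect[of "int n" "\<lambda>i. sgn (?d True True i - ?d True False (?j - i))" "int a'"] assms
      gp_dist_flip[of "int n" True True _ "int a'"]
    by simp
  ultimately show ?thesis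
    using assms by (simp add: card_Wset_GP_diff gp_excess_def gp_term_def UNIV_bool sum.distrib)
qed

text \<open>The reflection \<open>i \<mapsto> a + a' - i\<close> exchanges the two vertices.\<close>

lemma card_Wset_GP_same:
  assumes "24 \<le> n" "a < n" "a' < n"
  shows "card (Wset (GP_V n) (GP_E n 4) (b, a) (b, a')) = card (Wset (GP_V n) (GP_E n 4) (b, a') (b, a))"
proof -
  define g where "g i = (\<Sum>c\<in>UNIV.
    sgn (gp_dist (int n) c b (i - int a') - gp_dist (int n) c b (i - int a)))" for i
  have "g ((int a + int a' - i) mod int n) = - g i" for i
    by (simp add: g_def UNIV_bool gp_dist_flip[of _ _ _ i] sgn_minus[symmetric] algebra_simps
        del: sgn_minus)
  then have "(\<Sum>i\<in>{0..<int n}. g i) = 0"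
    using sum_mod_reflect[of "int n" g "int a + int a'"] assms by (simp add: sum_negf)
  then show ?thesis
    using card_Wset_GP_diff[OF assms, of b b] by (simp add: g_def)
qed

subsection \<open>Negativity of the excess\<close>

lemma gp_term_mod [simp]:
  "gp_term n (j mod n) i = gp_term n j i" "gp_term n j (i mod n) = gp_term n j i"
  by (simp_all add: gp_term_def)

lemma gp_excess_mod [simp]: "gp_excess n (j mod n) = gp_excess n j"
  by (simp add: gp_excess_def)

section \<open>Hop distance at least 6\<close>

text \<open>A shift by 3 counts as 4 - 1, hence as two steps instead of three.\<close>

lemma hop_dist_lipschitz:
  assumes "24 \<le> n" "\<bar>s\<bar> \<le> 3"
  shows "\<bar>fold_min hop n (x + s) - fold_min hop n x\<bar> \<le> 2"
proof -
  note step = hop_step1[OF assms(1)] and step4 = hop_step4[OF assms(1)]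
  consider "s = -3" | "s = -2" | "s = -1" | "s = 0" | "s = 1" | "s = 2" | "s = 3"
    using assms(2) by linarith
  then show ?thesis
  proof cases
    case 1 then show ?thesis using step4[of "x - 4"] step[of "x - 4"] by simp
  next
    case 2 then show ?thesis using step[of "x - 2"] step[of "x - 1"] by simp
  next
    case 3 then show ?thesis using step[of "x - 1"] by simp
  next
    case 5 then show ?thesis using step[of x] by simp
  next
    case 6 then show ?thesis using step[of x] step[of "x + 1"] by (simp add: add.assoc)
  next
    case 7 then show ?thesis using step4[of x] step[of "x + 3"] by (simp add: add.assoc)
  qed simp
qed

text \<open>The rim arc \<open>a\<close> must satisfy \<open>a < hop a + 2\<close>; as
  \<open>hop a\<close> grows like \<open>a / 4\<close>, only \<open>a \<le> 3\<close> survives. Only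
  such indices can have a positive term.\<close>

lemma rim_less_inner_imp_near:
  assumes n: "24 \<le> n" and less: "gp_dist n False False i < gp_dist n True True i"
  obtains s where "\<bar>s\<bar> \<le> 3" "n dvd i - s" "gp_dist n True True i \<le> 4"
proof -
  obtain a where a: "0 \<le> a" "a < n" "fold_min (\<lambda>a. a) n i = a" "n dvd i - a \<or> n dvd i + a"
    using fold_minE[of n "\<lambda>a. a" i] n by auto
  have "a < fold_min hop n i + 2"
    using less inner_le[OF n, of i] a(3) by (auto simp: gp_dist_def min_def split: if_splits)
  then have hop: "a < hop a + 2"
    using hop_fold_le[OF n a(1) _ a(4)] a(2) by simp
  then have "a \<noteq> 4" "a \<le> 4"
    using hop_upper[of a] by (auto simp: hop_small)
  then have small: "a \<le> 3" by simp
  then have "inner_hop a \<le> 4"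
    using inner_hop_upper[of a] hop_upper[of a] by linarith
  then have "gp_dist n True True i \<le> 4"
    using inner_fold_le[OF n a(1) _ a(4)] a(2) by (simp add: gp_dist_def)
  with small a(1,4) that[of a] that[of "- a"] show ?thesis by auto
qed

text \<open>A sum sgn (s - r) + sgn (t - s) is positive only if r \<le> s \<le> t and r < t.\<close>

lemma gp_term_nonpos:
  assumes "gp_dist n True True i \<le> gp_dist n False False i
    \<or> gp_dist n True True i < gp_dist n True False (j - i)"
  shows "gp_term n j i \<le> 0"
  using assms by (auto simp: gp_term_def sgn_if)

text \<open>Near residue 0 the inner distance is at most 4, while the spoke distance is at least 6 -
  2 + 1 = 5; hence the threshold 6.\<close>

lemma gp_term_nonpos_far:
  assumes n: "24 \<le> n" and j: "6 \<le> fold_min hop n j"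
  shows "gp_term n j i \<le> 0"
proof (cases "gp_dist n True True i \<le> gp_dist n False False i")
  case False
  then obtain s where s: "\<bar>s\<bar> \<le> 3" "n dvd i - s" "gp_dist n True True i \<le> 4"
    using rim_less_inner_imp_near[OF n] by (metis not_le)
  have "i mod n = s mod n"
    using s(2) by (simp add: mod_eq_dvd_iff)
  then have "(j - i) mod n = (j + - s) mod n"
    by (metis add_uminus_conv_diff mod_diff_right_eq)
  then have "fold_min hop n (j - i) = fold_min hop n (j + - s)"
    by (metis fold_min_mod)
  then have "gp_dist n True True i < gp_dist n True False (j - i)"
    using hop_dist_lipschitz[OF n, of "- s" j] s j by (simp add: gp_dist_def)
  then show ?thesis by (intro gp_term_nonpos) simp
qed (auto intro: gp_term_nonpos)

lemma gp_excess_neg_large: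
  assumes n: "24 \<le> n" and j: "0 \<le> j" "j < n" and le: "hop j \<le> hop (n - j)" and m: "6 \<le> hop j"
  shows "gp_excess n j < 0" "fold_min hop n j = hop j"
proof -
  note bounds = hop_lower hop_upper
  have eq: "fold_min hop n y = hop y" if "0 \<le> y" "y < n" "hop y \<le> hop (n - y)" for y
    using that by (cases "y = 0") (auto simp: fold_min_def zmod_zminus1_eq_if)
  show f: "fold_min hop n j = hop j"
    using eq[of j] j le by simp
  \<comment> \<open>\<open>v\<^sub>4\<^sub>t\<close> lies halfway on a shortest path, so its term is negative while no term is positive\<close>
  define t where "t = hop j div 2"
  have t: "2 * t \<le> hop j" "hop j \<le> 2 * t + 1" "3 \<le> t"
    using m by (auto simp: t_def)
  \<comment> \<open>Both arcs \<open>j\<close> and \<open>n - j\<close> have hop at least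
    \<open>hop j\<close>; adding the two upper bounds puts \<open>4 * t\<close> before
    \<open>j\<close> and in the first half of the cycle.\<close>
  have "n \<ge> 8 * hop j - 18"
    using le bounds[of j] bounds[of "n - j"] by linarith
  then have tn: "8 * t \<le> n" "4 * t \<le> j"
    using t bounds[of j] by linarith+
  have rep: "hop (y + 4 * k) = hop y + k" for y k
    by (simp add: hop_def)
  have "fold_min hop n (j - 4 * t) = hop j - t"
    using eq[of "j - 4 * t"] j tn t le rep[of "n - j" t] rep[of j "- t"]
    by (simp add: algebra_simps)
  then have spoke: "gp_dist n True False (j - 4 * t) = hop j - t + 1"
    by (simp add: gp_dist_def)
  have t_mod: "(4 * t) mod n = 4 * t" "(- (4 * t)) mod n = n - 4 * t"
    using tn t n by (auto simp: zmod_zminus1_eq_if)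
  have inner: "gp_dist n True True (4 * t) \<le> t"
    by (simp add: gp_dist_def fold_min_def t_mod) (simp add: inner_hop_def)
  have "fold_min hop n (4 * t) = t"
    using eq[of "4 * t"] t tn bounds(1)[of "n - 4 * t"] by simp
  then have rim: "gp_dist n False False (4 * t) \<ge> hop j - t + 1"
    using t tn by (simp add: gp_dist_def fold_min_def t_mod)
  \<comment> \<open>By the parity of \<open>hop j\<close> the spoke distance is \<open>t + 1\<close>
    or \<open>t + 2\<close>: above the inner distance, and at most the rim distance
    \<open>t + 2\<close>.\<close>
  have "gp_term n j (4 * t) < 0"
    using spoke inner rim t by (auto simp: gp_term_def sgn_if)
  moreover have "gp_term n j i \<le> 0" for i
    using gp_term_nonpos_far[OF n] f m by simp
  moreover have "4 * t \<in> {0..<n}"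
    using t tn by auto
  ultimately show "gp_excess n j < 0"
    using sum_strict_mono_ex1[of "{0..<n}" "gp_term n j" "\<lambda>_. 0"]
    unfolding gp_excess_def by (metis finite_atLeastLessThan_int sum.neutral_const)
qed

section \<open>Hop distance at most 5 for n at least 46\<close>

text \<open>The value of \<^term>\<open>gp_term n j i\<close> for \<open>i\<close> and \<open>j\<close> small compared with \<open>n\<close>.\<close>

definition local_term :: "int \<Rightarrow> int \<Rightarrow> int" where
  "local_term j i =
    sgn (hop \<bar>j - i\<bar> + 1 - min \<bar>i\<bar> (hop \<bar>i\<bar> + 2)) + sgn (inner_hop \<bar>i\<bar> - (hop \<bar>j - i\<bar> + 1))"

lemma fold_min_local:
  assumes "\<bar>x\<bar> < n" "g \<bar>x\<bar> \<le> g (n - \<bar>x\<bar>)"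
  shows "fold_min g n x = g \<bar>x\<bar>"
proof (cases "0 \<le> x")
  case True
  with assms show ?thesis
    by (cases "x = 0") (auto simp: fold_min_def zmod_zminus1_eq_if)
next
  case False
  then have "(- x) mod n = - x" "x mod n = n + x"
    using assms(1) zmod_zminus1_eq_if[of "- x" n] by auto
  with False assms show ?thesis by (simp add: fold_min_def)
qed

lemma hop_le_hop: "a + 6 \<le> b \<Longrightarrow> hop a \<le> hop b"
  using hop_upper[of a] hop_lower[of b] by linarith

text \<open>The bound 46 is 2 * 16 + 14: the slack of \<open>inner_hop\<close> is 6 + 8 = 14, and
  the arc through \<open>\<bar>i\<bar>\<close> must win. For \<open>hop\<close> the same count gives
  2 * 17 + 6 = 40.\<close>

lemma gp_term_local:
  assumes "46 \<le> n" "\<bar>i\<bar> \<le> 16" "\<bar>j - i\<bar> \<le> 17"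
  shows "gp_term n j i = local_term j i"
proof -
  have "inner_hop \<bar>i\<bar> \<le> inner_hop (n - \<bar>i\<bar>)"
    using assms inner_hop_upper[of "\<bar>i\<bar>"] hop_upper[of "\<bar>i\<bar>"] hop_lower[of "n - \<bar>i\<bar>"]
      inner_hop_lower[of "n - \<bar>i\<bar>"] by linarith
  then show ?thesis
    using assms hop_le_hop[of "\<bar>i\<bar>" "n - \<bar>i\<bar>"] hop_le_hop[of "\<bar>j - i\<bar>" "n - \<bar>j - i\<bar>"]
    by (simp add: gp_term_def local_term_def gp_dist_def fold_min_local)
qed

text \<open>The window contains -3, ..., 3, hence every index whose term can be positive; the rest
  of the period is discarded as nonpositive.\<close>

lemma gp_excess_le_local:
  assumes n: "46 \<le> n" and lo: "- 12 \<le> lo" "lo \<le> - 3" "j - lo \<le> 17"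
    and hi: "3 \<le> hi" "hi \<le> 16" "hi - j \<le> 17"
  shows "gp_excess n j \<le> (\<Sum>i\<in>{lo..hi}. local_term j i)"
proof -
  have "gp_excess n j = (\<Sum>i\<in>{lo..<lo + n}. gp_term n j (i mod n))"
    unfolding gp_excess_def using n by (intro sum_mod_shift[symmetric]) simp
  also have "\<dots> = (\<Sum>i\<in>{lo..hi}. gp_term n j i) + (\<Sum>i\<in>{hi<..<lo + n}. gp_term n j i)"
    using n lo hi by (subst sum.union_disjoint[symmetric]) (auto intro!: sum.cong)
  also have "(\<Sum>i\<in>{hi<..<lo + n}. gp_term n j i) \<le> 0"
  proof (intro sum_nonpos gp_term_nonpos disjI1)
    fix i assume i: "i \<in> {hi<..<lo + n}"
    show "gp_dist n True True i \<le> gp_dist n False False i"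
    proof (rule ccontr)
      assume "\<not> gp_dist n True True i \<le> gp_dist n False False i"
      then obtain s where s: "\<bar>s\<bar> \<le> 3" "n dvd i - s"
        using rim_less_inner_imp_near[of n i] n by auto
      have "0 < i - s" "i - s < n" using s(1) i lo hi by auto
      with s(2) show False using zdvd_not_zless by blast
    qed
  qed
  also have "(\<Sum>i\<in>{lo..hi}. gp_term n j i) = (\<Sum>i\<in>{lo..hi}. local_term j i)"
    using n lo hi by (intro sum.cong gp_term_local) auto
  finally show ?thesis by simp
qed

lemma sum_int_interval_code: "(\<Sum>i\<in>{lo..hi::int}. g i) = sum_list (map g [lo..hi])"
  by (simp add: interv_sum_list_conv_sum_set_int)

text \<open>For \<open>j = 0\<close> the indices \<plusminus>1, \<plusminus>2, \<plusminus>3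
  contribute 10 and each of \<plusminus>4, \<plusminus>8, \<plusminus>12 contributes -2, so the
  window has to reach 12.\<close>

lemma local_sums:
  "(\<Sum>i\<in>{-12..12}. local_term 0 i) < 0" "(\<Sum>i\<in>{-12..16}. local_term 4 i) < 0"
  "(\<Sum>i\<in>{-3..16}. local_term 3 i) < 0" "(\<Sum>i\<in>{-3..12}. local_term 12 i) < 0"
  "(\<Sum>i\<in>{-3..12}. local_term 13 i) < 0" "(\<Sum>i\<in>{-3..12}. local_term 14 i) < 0"
  unfolding sum_int_interval_code by code_simp+

lemma gp_excess_neg_small:
  assumes n: "46 \<le> n" and m: "0 \<le> m" "m \<le> 5"
  shows "\<exists>j. fold_min hop n j = m \<and> gp_excess n j < 0"
proof -
  have f: "fold_min hop n j = hop j" if "0 \<le> j" "j \<le> 20" for j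
    using that n hop_le_hop[of j "n - j"] by (simp add: fold_min_local)
  have "m = 0 \<or> m = 1 \<or> m = 2 \<or> m = 3 \<or> m = 4 \<or> m = 5" using m by linarith
  then consider "m = hop 0" | "m = hop 4" | "m = hop 3" | "m = hop 12" | "m = hop 13" | "m = hop 14"
    unfolding hop_def by auto
  then show ?thesis
  proof cases
    case 1
    with f[of 0] gp_excess_le_local[OF n, of "-12" 0 12] local_sums show ?thesis by (intro exI[of _ 0]) auto
  next
    case 2
    with f[of 4] gp_excess_le_local[OF n, of "-12" 4 16] local_sums show ?thesis by (intro exI[of _ 4]) auto
  next
    case 3
    with f[of 3] gp_excess_le_local[OF n, of "-3" 3 16] local_sums show ?thesis by (intro exI[of _ 3]) auto
  next
    case 4
    with f[of 12] gp_excess_le_local[OF n, of "-3" 12 12] local_sums show ?thesis by (intro exI[of _ 12]) auto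
  next
    case 5
    with f[of 13] gp_excess_le_local[OF n, of "-3" 13 12] local_sums show ?thesis by (intro exI[of _ 13]) auto
  next
    case 6
    with f[of 14] gp_excess_le_local[OF n, of "-3" 14 12] local_sums show ?thesis by (intro exI[of _ 14]) auto
  qed
qed

section \<open>Hop distance at most 5 for n from 25 to 45, by evaluation\<close>

definition neg_at :: "int \<Rightarrow> int \<Rightarrow> bool" where
  "neg_at j n \<longleftrightarrow> fold_min hop n j = hop j \<and> sum_list (map (gp_term n j) [0..n - 1]) < 0"

text \<open>For \<open>n = 30\<close> the witness 14 fails, since going the other way round gives \<open>hop 16 = 4 < hop 14\<close>;
  for \<open>n < 28\<close> no residue has hop distance 5.\<close>

lemma neg_at_table:
  "list_all (neg_at 0) [25..45]"
  "list_all (neg_at 4) [25..45]"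
  "list_all (neg_at 8) [25..45]"
  "list_all (neg_at 12) [25..45]"
  "list_all (neg_at 11) [25..45]"
  "list_all (\<lambda>n. neg_at (if n = 30 then 15 else 14) n) [28..45]"
  by code_simp+

lemma hop_dist_small_table:
  "list_all (\<lambda>n. list_all (\<lambda>x. fold_min hop n x \<le> 4) [0..n - 1]) [25..27]"
  by code_simp

lemma neg_at_imp:
  assumes "neg_at j n"
  shows "\<exists>i. fold_min hop n i = hop j \<and> gp_excess n i < 0"
  using assms unfolding neg_at_def gp_excess_def
  by (intro exI[of _ j]) (simp add: sum_int_interval_code[symmetric] flip: atLeastLessThanPlusOne_atLeastAtMost_int)

lemma gp_excess_neg_table:
  assumes n: "25 \<le> n" "n \<le> 45" and x: "fold_min hop n x = m" "m \<le> 5"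
  shows "\<exists>j. fold_min hop n j = m \<and> gp_excess n j < 0"
proof -
  have n_in: "n \<in> set [25..45]" using n unfolding set_upto by simp
  have neg: "neg_at j n" if "list_all (neg_at j) [25..45]" for j
    using that n_in unfolding list_all_iff by blast
  have "0 \<le> m"
    using x fold_nonneg(1)[of n x] n by simp
  moreover have "28 \<le> n" if "m = 5"
  proof (rule ccontr)
    assume "\<not> 28 \<le> n"
    then have "n \<in> set [25..27]" "x mod n \<in> set [0..n - 1]"
      using n unfolding set_upto by auto
    then have "fold_min hop n (x mod n) \<le> 4"
      using hop_dist_small_table unfolding list_all_iff by blast
    with x that show False by simp
  qed
  moreover have "n \<in> set [28..45]" if "28 \<le> n"
    using that n unfolding set_upto by simp
  moreover have "m = 0 \<or> m = 1 \<or> m = 2 \<or> m = 3 \<or> m = 4 \<or> m = 5" if "0 \<le> m"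
    using that x(2) by linarith
  ultimately consider "m = 0" | "m = 1" | "m = 2" | "m = 3" | "m = 4" | "m = 5" "n \<in> set [28..45]"
    by blast
  then show ?thesis
  proof cases
    case 6
    have "neg_at (if n = 30 then 15 else 14) n"
      using neg_at_table(6) 6(2) unfolding list_all_iff by blast
    from neg_at_imp[OF this] 6 show ?thesis by (simp add: hop_def split: if_splits)
  qed (use neg_at_imp[of 0 n] neg_at_imp[of 4 n] neg_at_imp[of 8 n] neg_at_imp[of 12 n]
      neg_at_imp[of 11 n] neg neg_at_table in \<open>auto simp: hop_def\<close>)
qed

lemma gp_excess_neg:
  assumes n: "25 \<le> n" and x: "fold_min hop n x = m"
  shows "\<exists>j. fold_min hop n j = m \<and> gp_excess n j < 0"
proof (cases "m \<le> 5")
  case True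
  have "0 \<le> m"
    using x fold_nonneg(1)[of n x] n by simp
  with True show ?thesis
    using gp_excess_neg_table[of n x m] gp_excess_neg_small[of n m] x n by force
next
  case False
  have large: "\<exists>j. fold_min hop n j = m \<and> gp_excess n j < 0"
    if "0 < j" "j < n" "hop j \<le> hop (n - j)" "m = hop j" for j
    using gp_excess_neg_large[of n j] that False n by auto
  have nz: "x mod n \<noteq> 0"
    using False x by (auto simp: fold_min_def hop_small zmod_zminus1_eq_if)
  then have minus: "(- x) mod n = n - x mod n"
    by (simp add: zmod_zminus1_eq_if)
  have pos: "0 < x mod n" "x mod n < n"
    using n nz pos_mod_sign[of n x] pos_mod_bound[of n x] by linarith+
  show ?thesis
  \<comment> \<open>The arc with the smaller hop value serves as the witness
    \<open>j\<close>.\<close>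
  proof (cases "hop (x mod n) \<le> hop (n - x mod n)")
    case True
    then show ?thesis using large[of "x mod n"] pos x by (simp add: fold_min_def minus)
  next
    case False
    then show ?thesis using large[of "n - x mod n"] pos x by (simp add: fold_min_def minus)
  qed
qed

section \<open>Attained distances and the final theorem\<close>

lemma hop_dist_intermediate:
  assumes n: "24 \<le> n" and k: "0 \<le> k" "k \<le> fold_min hop n x"
  shows "\<exists>y. fold_min hop n y = k"
proof -
  have "\<exists>i\<le>nat (x mod n). fold_min hop n (int i) = k"
  proof (rule nat0_intermed_int_val)
    have "\<bar>fold_min hop n (int (i + 1)) - fold_min hop n (int i)\<bar> \<le> 1" for i
      using hop_step1[OF n, of "int i"] by (simp add: add.commute)
    then show "\<forall>i<nat (x mod n). \<bar>fold_min hop n (int (i + 1)) - fold_min hop n (int i)\<bar> \<le> 1"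
      by blast
    show "fold_min hop n (int 0) \<le> k"
      using k by (simp add: fold_min_def hop_small)
    show "k \<le> fold_min hop n (int (nat (x mod n)))"
      using n k by simp
  qed
  then show ?thesis by blast
qed

lemma gp_dist_le: 
  assumes "24 \<le> n"
  shows "gp_dist n b c x \<le> fold_min hop n x + 2"
  using inner_le[OF assms, of x] by (auto simp: gp_dist_def)

lemma GP_nowhere_balanced_4:
  assumes n: "24 < n"
  shows "GP_nowhere_balanced n 4"
  unfolding GP_nowhere_balanced_def
proof (intro allI impI notI)
  let ?V = "GP_V n" and ?E = "GP_E n 4"
  fix l assume l: "1 \<le> l \<and> l < gdiam ?V ?E" and bal: "dist_balanced ?V ?E l"
  obtain p q where pq: "p \<in> ?V" "q \<in> ?V" "l < gdist ?V ?E p q"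
    using less_gdiamE[of ?V l ?E] l n GP_V_iff[of False 0 n] by (metis empty_iff finite_GP_V less_nat_zero_code not_gr_zero)
  obtain b i c j where [simp]: "p = (b, i)" "q = (c, j)" by fastforce
  have "int l < gp_dist (int n) b c (int i - int j)"
    using pq gdist_GP[of n i j b c] n by simp
  also have "\<dots> \<le> fold_min hop (int n) (int i - int j) + 2"
    using n by (intro gp_dist_le) simp
  \<comment> \<open>Every distance is at most a hop distance plus 2, so \<open>l - 1\<close> does
    not exceed some hop distance and is itself attained; the spoke adds the missing 1.\<close>
  finally obtain y where "fold_min hop (int n) y = int l - 1"
    using hop_dist_intermediate[of "int n" "int l - 1" "int i - int j"] l n by auto
  then obtain k where k: "fold_min hop (int n) k = int l - 1" "gp_excess (int n) k < 0"
    using gp_excess_neg[of "int n" y] n by auto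
  define m where "m = nat (k mod int n)"
  have m: "m < n" "int m = k mod int n"
    using n by (simp_all add: m_def nat_less_iff)
  have "int (gdist ?V ?E (False, 0) (True, m)) = gp_dist (int n) False True (- k)"
    using gdist_GP[of n 0 m False True] m n gp_dist_mod_diff(2)[of "int n" False True 0 k] by simp
  also have "\<dots> = int l"
    using k by (simp add: gp_dist_def)
  finally have "card (Wset ?V ?E (False, 0) (True, m)) = card (Wset ?V ?E (True, m) (False, 0))"
    using bal[unfolded dist_balanced_def, rule_format, of "(False, 0)" "(True, m)"] m n by simp
  with card_Wset_GP_diff_spoke[of n 0 m] k m n show False by simp
qed

text \<open>The residues 12 and -12 coincide here: \<plusminus>4, \<plusminus>8 and 12 contribute
  -10 in all, cancelling the 10 from \<plusminus>1, \<plusminus>2, \<plusminus>3.\<close>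

lemma gp_excess_24: "gp_excess 24 0 = 0"
proof -
  have "sum_list (map (gp_term 24 0) [0..23]) = 0" by code_simp
  then show ?thesis
    by (simp add: gp_excess_def sum_int_interval_code[symmetric] flip: atLeastLessThanPlusOne_atLeastAtMost_int)
qed

lemma not_GP_nowhere_balanced_24: "\<not> GP_nowhere_balanced 24 4"
proof -
  let ?V = "GP_V 24" and ?E = "GP_E 24 4"
  have "int (gdist ?V ?E (False, 0) (False, 2)) = 2"
    by (simp add: gdist_GP gp_dist_def fold_min_def hop_def)
  then have "1 < gdiam ?V ?E"
    by (intro less_gdiam[of ?V "(False, 0)" "(False, 2)"]) auto
  moreover have "dist_balanced ?V ?E 1"
    unfolding dist_balanced_def
  proof (intro ballI impI)
    fix p q assume pq: "p \<in> ?V" "q \<in> ?V" "gdist ?V ?E p q = 1"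
    obtain b i c j where [simp]: "p = (b, i)" "q = (c, j)" by fastforce
    show "card (Wset ?V ?E p q) = card (Wset ?V ?E q p)"
    proof (cases "b = c")
      case True
      with pq show ?thesis using card_Wset_GP_same[of 24 i j b] by simp
    next
      case False
      have "gp_dist 24 b c (int i - int j) = 1"
        using pq gdist_GP[of 24 i j b c] by simp
      \<comment> \<open>Adjacent vertices of unlike kinds form a spoke, so their excess is the one
        for \<open>j = 0\<close>.\<close>
      with False have "fold_min hop 24 (int i - int j) = 0"
        by (simp add: gp_dist_def)
      then have "(24::int) dvd int i - int j"
        by (intro hop_dist_eq_0) auto
      then have "int i mod 24 = int j mod 24"
        by (simp add: mod_eq_dvd_iff)
      with pq have "i = j" by simp
      with False pq card_Wset_GP_diff_spoke[of 24 i i] gp_excess_24 show ?thesis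
        by (cases b) auto
    qed
  qed
  ultimately show ?thesis
    unfolding GP_nowhere_balanced_def by (metis order.refl)
qed

theorem theorem1p4:
  shows "(\<forall>n::nat. n > 24 \<longrightarrow> GP_nowhere_balanced n 4)
       \<and> (\<forall>N::int. N < 24 \<longrightarrow> (\<exists>n::nat. int n > N \<and> 2 * 4 < n \<and> \<not> GP_nowhere_balanced n 4))"
proof (intro conjI allI impI)
  fix N :: int assume "N < 24"
  then show "\<exists>n::nat. int n > N \<and> 2 * 4 < n \<and> \<not> GP_nowhere_balanced n 4"
    using not_GP_nowhere_balanced_24 by (intro exI[of _ 24]) simp
qed (rule GP_nowhere_balanced_4)

end
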